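(* Let $T$ be a triangle mesh tessellating a planar region, with set of triangles $F$. Then the energy functional $\mathcal{E}$ attains its maximum over the set $\mathbf{A}_T$ of angle structures of $T$ at exactly one point, namely the angle structure in which all triangles are equilateral, i.e. in which every inner angle equals $\pi/3$.
   Context: A triangle mesh $T$ here is a finite triangulation of a compact planar region, with vertex set $V=\{1,\dots,n\}$ and set of triangles $F$; only its combinatorial structure is kept fixed. The triangle with vertices $i,j,k$ is denoted $ijk$. An angle structure assigns to each triangle $ijk\in F$ and each of its vertices a real number, where $\alpha^i_{jk}$ is the number (the "inner angle") assigned at vertex $i$ in triangle $ijk$. The set of angle structures is $$\mathbf{A}_T=\Big\{(\dots,\alpha^i_{jk},\alpha^j_{ki},\alpha^k_{ij},\dots)\in\mathbb{R}^{3|F|} : \text{for all } ijk\in F,\ \alpha^i_{jk}+\alpha^j_{ki}+\alpha^k_{ij}=\pi,\ \alpha^i_{jk}>0,\ \alpha^j_{ki}>0,\ \alpha^k_{ij}>0\Big\}.$$ No angle-sum or other conditions are imposed at the vertices. The Lobachevsky function is $\Lambda(x)=-\int_0^x \ln|2\sin t|\,dt$. The energy functional $\mathcal{E}:\mathbf{A}_T\to\mathbb{R}$ is $$\mathcal{E}(A)=\sum_{ijk\in F}\big(\Lambda(\alpha^i_{jk})+\Lambda(\alpha^j_{ki})+\Lambda(\alpha^k_{ij})\big).$$ *)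

theory Defs
  imports "HOL-Analysis.Analysis"
begin

text \<open>
  A triangle mesh is its combinatorial structure: the vertices are \<open>1, \<dots>, n\<close> and a triangle
  \<open>ijk\<close> is the set \<open>{i, j, k}\<close>. The vertex positions \<open>p\<close> only witness that the structure comes
  from a triangulation of the planar set \<open>R\<close>; injectivity of \<open>p\<close> together with \<open>triangulation\<close>
  (two cells meet in a common face) makes geometric incidence agree with incidence of index sets.
  Neither connectedness nor nonemptiness of \<open>R\<close> is required.
\<close>

definition triangle_mesh :: "nat \<Rightarrow> nat set set \<Rightarrow> (real^2) set \<Rightarrow> bool" where
  "triangle_mesh n F R \<longleftrightarrow>
     \<Union>F = {1..n} \<and> (\<forall>t\<in>F. card t = 3) \<and>
     (\<exists>p :: nat \<Rightarrow> real^2.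
        inj_on p {1..n} \<and>
        (\<forall>t\<in>F. 2 simplex (convex hull (p ` t))) \<and>
        triangulation ((\<lambda>t. convex hull (p ` t)) ` F) \<and>
        R = (\<Union>t\<in>F. convex hull (p ` t)))"

lemma triangle_mesh_finite:
  assumes "triangle_mesh n F R"
  shows "finite F"
proof -
  have "F \<subseteq> Pow {1..n}"
    using assms by (auto simp: triangle_mesh_def)
  then show ?thesis
    by (rule finite_subset) simp
qed

lemma triangle_mesh_compact:
  assumes "triangle_mesh n F R"
  shows "compact R"
proof -
  obtain p :: "nat \<Rightarrow> real^2" where R: "R = (\<Union>t\<in>F. convex hull (p ` t))"
    using assms by (auto simp: triangle_mesh_def)
  have "finite t" if "t \<in> F" for t
    using assms that by (intro card_ge_0_finite) (auto simp: triangle_mesh_def)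
  then show ?thesis
    unfolding R using triangle_mesh_finite[OF assms]
    by (intro compact_UN) (auto intro: finite_imp_compact_convex_hull)
qed

text \<open>
  The angle at vertex \<open>i\<close> of the triangle \<open>t = {i, j, k}\<close> is the coordinate \<open>A (t, i)\<close>. Angle
  structures are extensional functions on the \<open>3|F|\<close> corners, so that equality of functions is
  equality of points of \<open>\<real>\<^sup>3\<^sup>|\<^sup>F\<^sup>|\<close>.
\<close>

definition corners :: "nat set set \<Rightarrow> (nat set \<times> nat) set" where
  "corners F = (SIGMA t:F. t)"

definition angle_structures :: "nat set set \<Rightarrow> (nat set \<times> nat \<Rightarrow> real) set" where
  "angle_structures F =
     {A \<in> corners F \<rightarrow>\<^sub>E UNIV.
        \<forall>t\<in>F. (\<Sum>i\<in>t. A (t, i)) = pi \<and> (\<forall>i\<in>t. A (t, i) > 0)}"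

text \<open>
  The interval integral is signed for \<open>x < 0\<close>. At the logarithmic singularities, which form a
  null set, the integrand has the conventional value \<open>ln 0\<close>.
\<close>

definition Lobachevsky :: "real \<Rightarrow> real" where
  "Lobachevsky x = - (LBINT t=ereal 0..ereal x. ln \<bar>2 * sin t\<bar>)"

definition energy :: "nat set set \<Rightarrow> (nat set \<times> nat \<Rightarrow> real) \<Rightarrow> real" where
  "energy F A = (\<Sum>t\<in>F. \<Sum>i\<in>t. Lobachevsky (A (t, i)))"

definition equilateral :: "nat set set \<Rightarrow> nat set \<times> nat \<Rightarrow> real" where
  "equilateral F = (\<lambda>c\<in>corners F. pi / 3)"

end

(*
  Move from the equilateral triangle to a triangle with angles a, b, c along the segment
  x(s) = pi/3 + s * (a - pi/3), and similarly y(s), z(s). As Lambda'(x) = - ln (2 sin x) on (0, pi),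
  s times the derivative of the energy along the segment is minus the sum of
  (x(s) - pi/3) * ln (2 sin x(s)) over the three angles. In a triangle the larger angle has the
  larger sine, so this sum is positive by Chebyshev's sum inequality unless all angles agree, and the
  energy strictly decreases. As there are no conditions at the vertices, the triangles can be treated
  separately.
*)
theory Submission
  imports Defs "HOL-Real_Asymp.Real_Asymp"
begin

section \<open>Integrability of the log-sine and the derivative of the Lobachevsky function\<close>

lemma sin_ge_half:
  fixes t :: real
  assumes "0 \<le> t" "t \<le> 1"
  shows "t / 2 \<le> sin t"
proof -
  have "(\<lambda>u. sin u - u / 2) 0 \<le> (\<lambda>u. sin u - u / 2) t"
  proof (rule DERIV_nonneg_imp_nondecreasing[OF assms(1)])
    fix u :: real assume u: "0 \<le> u" "u \<le> t"
    \<comment> \<open>Here \<open>u \<le> 1 < pi / 3\<close>, and cos (pi / 3) is the slope 1/2 of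
      the linear bound.\<close>
    have "cos (pi / 3) \<le> cos u"
      using u assms pi_gt3 by (intro cos_monotone_0_pi_le) auto
    then have "0 \<le> cos u - 1 / 2" by (simp add: cos_60)
    moreover have "((\<lambda>u. sin u - u / 2) has_real_derivative cos u - 1 / 2) (at u)"
      by (auto intro!: derivative_eq_intros)
    ultimately show "\<exists>y. ((\<lambda>u. sin u - u / 2) has_real_derivative y) (at u) \<and> y \<ge> 0"
      by blast
  qed
  then show ?thesis by simp
qed

text \<open>The antiderivative \<open>t - t * ln t\<close> has finite limits 0 and 1 at the ends.
  The sign makes the integrand nonnegative, so that the fundamental theorem yields integrability as
  well.\<close>

lemma set_integrable_neg_ln: "set_integrable lborel {0<..<1::real} (\<lambda>t. - ln t)"
proof -
  let ?F = "\<lambda>t::real. t - t * ln t"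
  have "set_integrable lborel (einterval (ereal 0) (ereal 1)) (\<lambda>t::real. - ln t)"
  proof (rule interval_integral_FTC_nonneg(1))
    show "((?F \<circ> real_of_ereal) \<longlongrightarrow> 0) (at_right (ereal 0))"
      unfolding ereal_tendsto_simps1 by real_asymp
    show "((?F \<circ> real_of_ereal) \<longlongrightarrow> 1) (at_left (ereal 1))"
      unfolding ereal_tendsto_simps1 by real_asymp
    show "(?F has_real_derivative - ln x) (at x)" if "ereal 0 < ereal x" "ereal x < ereal 1" for x
      using that by (auto intro!: derivative_eq_intros)
  qed (auto intro!: continuous_intros)
  then show ?thesis by simp
qed

lemma isCont_ln_sin:
  fixes x :: real
  assumes "0 < x" "x < pi"
  shows "isCont (\<lambda>t. ln \<bar>2 * sin t\<bar>) x"
  using sin_gt_zero[OF assms] by (intro continuous_intros) auto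

text \<open>Since \<open>t \<le> 2 * sin t \<le> 2\<close> on (0, 1), the singularity at 0 is no
  worse than that of the logarithm: the absolute value is at most ln 2 - ln t.\<close>

lemma set_integrable_ln_sin_unit: "set_integrable lborel {0<..<1::real} (\<lambda>t. ln \<bar>2 * sin t\<bar>)"
proof (rule set_integrable_bound)
  show "set_integrable lborel {0<..<1::real} (\<lambda>t. - ln t + ln 2)"
    by (intro set_integral_add set_integrable_neg_ln) (simp add: set_integrable_def)
  show "set_borel_measurable lborel {0<..<1::real} (\<lambda>t. ln \<bar>2 * sin t\<bar>)"
    unfolding set_borel_measurable_def by measurable
  have "norm (ln \<bar>2 * sin t\<bar>) \<le> norm (- ln t + ln 2)" if "0 < t" "t < 1" for t :: real
  proof -
    have lower: "t \<le> 2 * sin t" using sin_ge_half[of t] that by simp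
    have upper: "2 * sin t \<le> 2" by simp
    have "ln t \<le> ln (2 * sin t)" "ln (2 * sin t) \<le> ln 2" "ln t \<le> 0"
      using lower upper that by auto
    moreover have "0 \<le> ln (2::real)" by simp
    moreover have "\<bar>2 * sin t\<bar> = 2 * sin t" using lower that by simp
    ultimately show ?thesis unfolding real_norm_def by linarith
  qed
  then show "AE t in lborel. t \<in> {0<..<1::real} \<longrightarrow>
      norm (ln \<bar>2 * sin t\<bar>) \<le> norm (- ln t + ln 2)"
    by (intro AE_I2) auto
qed

lemma set_integrable_ln_sin:
  fixes x :: real
  assumes "x < pi"
  shows "set_integrable lborel {0<..<x} (\<lambda>t. ln \<bar>2 * sin t\<bar>)"
proof -
  \<comment> \<open>The cut point 1/2 stays away from the singularity at 0 and lies inside (0, 1),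
    so the two pieces cover (0, x).\<close>
  have "continuous_on {1/2..x} (\<lambda>t. ln \<bar>2 * sin t\<bar>)"
    using assms by (intro continuous_at_imp_continuous_on ballI isCont_ln_sin) auto
  then have "set_integrable lborel {1/2..x} (\<lambda>t. ln \<bar>2 * sin t\<bar>)"
    by (rule borel_integrable_atLeastAtMost')
  then have "set_integrable lborel ({0<..<1} \<union> {1/2..x}) (\<lambda>t. ln \<bar>2 * sin t\<bar>)"
    by (intro set_integrable_Un set_integrable_ln_sin_unit) auto
  then show ?thesis
    by (rule set_integrable_subset) auto
qed

text \<open>The integrand is singular at the base point 0, so the fundamental theorem is applied
  from an interior point \<open>a\<close>. Integrability down to 0 ensures that this changes the
  integral only by a constant.\<close>

lemma Lobachevsky_has_derivative:
  fixes x :: real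
  assumes "0 < x" "x < pi"
  shows "(Lobachevsky has_real_derivative - ln \<bar>2 * sin x\<bar>) (at x)"
proof -
  let ?f = "\<lambda>t::real. ln \<bar>2 * sin t\<bar>"
  \<comment> \<open>Midpoints of (0, x) and (x, pi): \<open>{a..b}\<close> is a neighbourhood of
    \<open>x\<close> free of singularities.\<close>
  define a where "a = x / 2"
  define b where "b = (x + pi) / 2"
  have ab: "0 < a" "a < x" "x < b" "b < pi" using assms by (auto simp: a_def b_def)
  have split: "Lobachevsky u = Lobachevsky a - (LBINT t=ereal a..ereal u. ?f t)" if "u \<in> {a<..<b}" for u
  proof -
    have "set_integrable lborel {0<..<u} ?f"
      using that ab by (intro set_integrable_ln_sin) auto
    then have "(LBINT t=ereal 0..ereal a. ?f t) + (LBINT t=ereal a..ereal u. ?f t)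
        = (LBINT t=ereal 0..ereal u. ?f t)"
      using that ab by (intro interval_integral_sum)
        (auto simp: interval_lebesgue_integrable_def min_def max_def)
    then show ?thesis by (simp add: Lobachevsky_def)
  qed
  have "continuous_on {a..b} ?f"
    using ab by (intro continuous_at_imp_continuous_on ballI isCont_ln_sin) auto
  then have "((\<lambda>u. LBINT t=ereal a..ereal u. ?f t) has_vector_derivative ?f x) (at x within {a..b})"
    using ab by (intro interval_integral_FTC2) auto
  then have "((\<lambda>u. LBINT t=ereal a..ereal u. ?f t) has_real_derivative ?f x) (at x within {a<..<b})"
    unfolding has_real_derivative_iff_has_vector_derivative
    by (rule has_vector_derivative_within_subset) auto
  then have "((\<lambda>u. LBINT t=ereal a..ereal u. ?f t) has_real_derivative ?f x) (at x)"
    using ab by (subst (asm) at_within_open) auto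
  then have "((\<lambda>u. Lobachevsky a - (LBINT t=ereal a..ereal u. ?f t)) has_real_derivative - ?f x) (at x)"
    by (auto intro!: derivative_eq_intros)
  then show ?thesis
    by (rule has_field_derivative_transform_within_open[of _ _ _ "{a<..<b}"])
      (use ab split in auto)
qed

section \<open>Chebyshev's sum inequality and the energy of a single triangle\<close>

lemma sin_strict_mono_triangle:
  fixes x y :: real
  assumes "0 < x" "x < y" "x + y < pi"
  shows "sin x < sin y"
proof -
  \<comment> \<open>The larger angle may exceed pi / 2, where sine decreases. The product formula
    for sin y - sin x only needs the half sum to be below pi / 2.\<close>
  have "0 < sin ((y - x) / 2)" using assms by (intro sin_gt_zero) auto
  moreover have "0 < cos ((y + x) / 2)" using assms by (intro cos_gt_zero) auto
  ultimately have "0 < sin y - sin x" by (simp add: sin_diff_sin)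
  then show ?thesis by simp
qed

lemma ln_sin_similarly_ordered:
  fixes x y :: real
  assumes "0 < x" "0 < y" "x + y < pi" "x \<noteq> y"
  shows "0 < (x - y) * (ln \<bar>2 * sin x\<bar> - ln \<bar>2 * sin y\<bar>)"
  using assms
proof (induction x y rule: linorder_wlog)
  case (le x y)
  have "0 < sin x" using le by (intro sin_gt_zero) auto
  moreover have "sin x < sin y" using le by (intro sin_strict_mono_triangle) auto
  ultimately have "ln \<bar>2 * sin x\<bar> < ln \<bar>2 * sin y\<bar>" by simp
  then show ?case using le by (intro mult_neg_neg) auto
next
  case (sym x y)
  then show ?case by (simp add: algebra_simps)
qed

lemma sum_ln_sin_pos:
  fixes x y z :: real
  assumes pos: "0 < x" "0 < y" "0 < z" and sum: "x + y + z = pi"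
    and ne: "x \<noteq> pi / 3 \<or> y \<noteq> pi / 3"
  shows "0 < (x - pi / 3) * ln \<bar>2 * sin x\<bar> + (y - pi / 3) * ln \<bar>2 * sin y\<bar>
    + (z - pi / 3) * ln \<bar>2 * sin z\<bar>"
proof -
  let ?f = "\<lambda>t::real. ln \<bar>2 * sin t\<bar>"
  have weak: "0 \<le> (u - v) * (?f u - ?f v)" if "0 < u" "0 < v" "u + v < pi" for u v
    using ln_sin_similarly_ordered[OF that] by (cases "u = v") auto
  have nonneg: "0 \<le> (x - y) * (?f x - ?f y)" "0 \<le> (y - z) * (?f y - ?f z)"
      "0 \<le> (x - z) * (?f x - ?f z)"
    using pos sum by (auto intro!: weak)
  \<comment> \<open>Three equal angles with sum pi would all be pi / 3. If not all agree, one of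
    these two pairs already differs.\<close>
  have "x \<noteq> y \<or> y \<noteq> z" using ne sum by auto
  then have strict: "0 < (x - y) * (?f x - ?f y) \<or> 0 < (y - z) * (?f y - ?f z)"
    using pos sum by (auto intro!: ln_sin_similarly_ordered simp del: zero_less_mult_iff mult_pos_pos)
  \<comment> \<open>The identity behind Chebyshev's inequality: pi / 3 is the mean of the angles, so
    the sum turns into products of differences over the three pairs.\<close>
  have "3 * ((x - pi / 3) * ?f x + (y - pi / 3) * ?f y + (z - pi / 3) * ?f z)
     = (x - y) * (?f x - ?f y) + (y - z) * (?f y - ?f z) + (x - z) * (?f x - ?f z)"
    unfolding sum[symmetric] by (simp add: field_simps)
  also have "0 < \<dots>"
    using strict
  proof
    assume "0 < (x - y) * (?f x - ?f y)"
    then show ?thesis by (rule add_pos_nonneg[OF add_pos_nonneg[OF _ nonneg(2)] nonneg(3)])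
  next
    assume "0 < (y - z) * (?f y - ?f z)"
    then show ?thesis by (rule add_pos_nonneg[OF add_nonneg_pos[OF nonneg(1)] nonneg(3)])
  qed
  finally show ?thesis by simp
qed

lemma Lobachevsky_sum_less:
  fixes a b c :: real
  assumes pos: "0 < a" "0 < b" "0 < c" and sum: "a + b + c = pi"
    and ne: "a \<noteq> pi / 3 \<or> b \<noteq> pi / 3"
  shows "Lobachevsky a + Lobachevsky b + Lobachevsky c < 3 * Lobachevsky (pi / 3)"
proof -
  let ?f = "\<lambda>t::real. ln \<bar>2 * sin t\<bar>"
  define p where "p u s = pi / 3 + s * (u - pi / 3)" for u s :: real
  define h where "h s = Lobachevsky (p a s) + Lobachevsky (p b s) + Lobachevsky (p c s)" for s
  \<comment> \<open>The convex form shows that the angles stay positive. With their sum fixed at pi,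
    each also stays below pi, where the derivative formula holds.\<close>
  have p_convex: "p u s = (1 - s) * (pi / 3) + s * u" for u s
    by (simp add: p_def field_simps)
  have p_pos: "0 < p u s" if "0 < u" "0 \<le> s" "s \<le> 1" for u s
    unfolding p_convex using that
    by (cases "s = 0") (auto intro!: add_nonneg_pos mult_nonneg_nonneg)
  have p_sum: "p a s + p b s + p c s = pi" for s
  proof -
    have "p a s + p b s + p c s = pi + s * (a + b + c - pi)"
      by (simp add: p_def algebra_simps)
    then show ?thesis using sum by simp
  qed
  have deriv: "(h has_real_derivative
      - ((a - pi / 3) * ?f (p a s) + (b - pi / 3) * ?f (p b s) + (c - pi / 3) * ?f (p c s))) (at s)"
    if s: "0 \<le> s" "s \<le> 1" for s
  proof -
    have dp: "((\<lambda>s. p u s) has_real_derivative u - pi / 3) (at s)" for u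
      unfolding p_def by (auto intro!: derivative_eq_intros)
    have "((\<lambda>s. Lobachevsky (p u s)) has_real_derivative - ?f (p u s) * (u - pi / 3)) (at s)"
      if "u \<in> {a, b, c}" for u
    proof (rule DERIV_chain2[OF Lobachevsky_has_derivative dp])
      show "0 < p u s" "p u s < pi"
        using that p_pos[OF pos(1) s] p_pos[OF pos(2) s] p_pos[OF pos(3) s] p_sum[of s] by auto
    qed
    then show ?thesis
      unfolding h_def by (auto intro!: derivative_eq_intros simp: algebra_simps)
  qed
  \<comment> \<open>The derivative vanishes at s = 0, where the three logarithms agree and their
    coefficients sum to 0. Hence its sign is only checked on the open interval.\<close>
  have "h 1 < h 0"
  proof (rule DERIV_neg_imp_decreasing_open[where f = h])
    fix s :: real assume s: "0 < s" "s < 1"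
    \<comment> \<open>Chebyshev's inequality concerns the deviations of the moving angles, which are
      \<open>s\<close> times the velocities in the derivative; dividing by \<open>s > 0\<close>
      keeps the sign.\<close>
    have scale: "p u s - pi / 3 = s * (u - pi / 3)" for u by (simp add: p_def)
    have "0 < (p a s - pi / 3) * ?f (p a s) + (p b s - pi / 3) * ?f (p b s)
        + (p c s - pi / 3) * ?f (p c s)"
      using s pos p_sum ne by (intro sum_ln_sin_pos p_pos) (auto simp: p_def)
    also have "\<dots> = s * ((a - pi / 3) * ?f (p a s) + (b - pi / 3) * ?f (p b s)
        + (c - pi / 3) * ?f (p c s))"
      unfolding scale by (simp add: algebra_simps)
    finally have "0 < (a - pi / 3) * ?f (p a s) + (b - pi / 3) * ?f (p b s)
        + (c - pi / 3) * ?f (p c s)"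
      using s by (simp add: zero_less_mult_iff)
    then have "- ((a - pi / 3) * ?f (p a s) + (b - pi / 3) * ?f (p b s)
        + (c - pi / 3) * ?f (p c s)) < 0"
      by (simp only: neg_less_0_iff_less)
    with deriv[of s] s show "\<exists>y. (h has_real_derivative y) (at s) \<and> y < 0"
      by (meson less_imp_le)
  next
    show "continuous_on {0..1} h"
      by (intro continuous_at_imp_continuous_on ballI DERIV_isCont[OF deriv]) auto
  qed simp
  then show ?thesis by (simp add: h_def p_def)
qed

section \<open>From one triangle to the whole mesh\<close>

lemma triangle_energy_less:
  fixes t :: "nat set" and B :: "nat \<Rightarrow> real"
  assumes "card t = 3" "(\<Sum>i\<in>t. B i) = pi" "\<And>i. i \<in> t \<Longrightarrow> 0 < B i"
    and ne: "\<exists>i\<in>t. B i \<noteq> pi / 3"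
  shows "(\<Sum>i\<in>t. Lobachevsky (B i)) < (\<Sum>i\<in>t. Lobachevsky (pi / 3))"
proof -
  obtain i j k where t: "t = {i, j, k}" and d: "i \<noteq> j" "j \<noteq> k" "i \<noteq> k"
    using assms(1) by (auto simp: card_3_iff)
  have sum: "B i + B j + B k = pi" using assms(2) d by (simp add: t)
  have "Lobachevsky (B i) + Lobachevsky (B j) + Lobachevsky (B k) < 3 * Lobachevsky (pi / 3)"
    using assms(3) ne sum by (intro Lobachevsky_sum_less) (auto simp: t)
  then show ?thesis using d by (simp add: t)
qed

theorem mainTheorem2:
  fixes n :: nat and F :: "nat set set" and R :: "(real^2) set"
  assumes "triangle_mesh n F R"
  shows "{A \<in> angle_structures F. \<forall>B \<in> angle_structures F. energy F B \<le> energy F A}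
         = {equilateral F}"
proof -
  have fin: "finite F" using assms by (rule triangle_mesh_finite)
  have card: "card t = 3" if "t \<in> F" for t using assms that by (simp add: triangle_mesh_def)
  let ?E = "equilateral F"
  have E: "?E (t, i) = pi / 3" if "t \<in> F" "i \<in> t" for t i
    using that by (simp add: equilateral_def corners_def)
  have E_in: "?E \<in> angle_structures F"
  proof -
    have "?E \<in> corners F \<rightarrow>\<^sub>E UNIV" by (simp add: equilateral_def)
    moreover have "(\<Sum>i\<in>t. ?E (t, i)) = pi" if "t \<in> F" for t
    proof -
      have "(\<Sum>i\<in>t. ?E (t, i)) = (\<Sum>i\<in>t. pi / 3)" using E[OF that] by (rule sum.cong[OF refl])
      then show ?thesis using card[OF that] by simp
    qed
    moreover have "0 < ?E (t, i)" if "t \<in> F" "i \<in> t" for t i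
      unfolding E[OF that] by simp
    ultimately show ?thesis unfolding angle_structures_def by blast
  qed
  \<comment> \<open>Strictness against every other angle structure gives maximality and uniqueness
    at once.\<close>
  have less: "energy F A < energy F ?E" if A: "A \<in> angle_structures F" and "A \<noteq> ?E" for A
  proof -
    have ext: "A \<in> extensional (corners F)" "?E \<in> extensional (corners F)"
      using A by (auto simp: angle_structures_def equilateral_def PiE_def)
    have local_less: "(\<Sum>i\<in>t. Lobachevsky (A (t, i))) < (\<Sum>i\<in>t. Lobachevsky (?E (t, i)))"
      if "t \<in> F" "\<exists>i\<in>t. A (t, i) \<noteq> pi / 3" for t
    proof -
      have "(\<Sum>i\<in>t. Lobachevsky (A (t, i))) < (\<Sum>i\<in>t. Lobachevsky (pi / 3))"
        using that A card by (intro triangle_energy_less) (auto simp: angle_structures_def)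
      also have "\<dots> = (\<Sum>i\<in>t. Lobachevsky (?E (t, i)))"
        by (intro sum.cong) (simp_all only: E[OF that(1)])
      finally show ?thesis .
    qed
    have local_le: "(\<Sum>i\<in>t. Lobachevsky (A (t, i))) \<le> (\<Sum>i\<in>t. Lobachevsky (?E (t, i)))"
      if "t \<in> F" for t
    proof (cases "\<exists>i\<in>t. A (t, i) \<noteq> pi / 3")
      case True
      then show ?thesis using local_less[OF that] by simp
    next
      case False
      then have "A (t, i) = ?E (t, i)" if "i \<in> t" for i
        using E[OF \<open>t \<in> F\<close> that] that by metis
      then show ?thesis by (intro sum_mono) simp
    qed
    \<comment> \<open>Both functions are \<open>undefined\<close> off the corners, so distinct ones
      must differ at a corner.\<close>
    have "\<exists>t\<in>F. \<exists>i\<in>t. A (t, i) \<noteq> pi / 3"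
    proof (rule ccontr)
      assume *: "\<not> ?thesis"
      have "A = ?E"
        by (rule extensionalityI[OF ext]) (use * in \<open>auto simp: corners_def E\<close>)
      with \<open>A \<noteq> ?E\<close> show False ..
    qed
    \<comment> \<open>No triangle gains energy over the equilateral one, and at least one strictly
      loses.\<close>
    then show ?thesis
      unfolding energy_def using local_le local_less by (intro sum_strict_mono_ex1 fin) auto
  qed
  show ?thesis
  proof (intro equalityI subsetI)
    fix A assume "A \<in> {A \<in> angle_structures F. \<forall>B \<in> angle_structures F. energy F B \<le> energy F A}"
    then show "A \<in> {?E}" using less[of A] E_in by force
  next
    fix A assume "A \<in> {?E}"
    then show "A \<in> {A \<in> angle_structures F. \<forall>B \<in> angle_structures F. energy F B \<le> energy F A}"
      using less E_in by (auto intro: less_imp_le)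
  qed
qed

end
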